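(* Let $X$ be a non-empty set of positive integers with $X\neq\{1\}$. Both graphs $\Gamma(X)$ and $\Delta(X)$ are acyclic if and only if each connected component of $B(X)$ is a path or a cycle of length $4$.
   Context: For a non-empty set $X$ of positive integers, $\rho(X)$ is the set of primes dividing some element of $X$ and $X^*=X\setminus\{1\}$. $B(X)$ is the bipartite graph with vertex set the disjoint union $\rho(X)\cup X^*$ and edges $\{p,x\}$ for $p\in\rho(X)$, $x\in X^*$, $p\mid x$. $\Delta(X)$ has vertex set $\rho(X)$, distinct $p,q$ adjacent iff $pq$ divides some element of $X$. $\Gamma(X)$ has vertex set $X^*$, distinct $x,y$ adjacent iff $\gcd(x,y)>1$. A graph is acyclic if it contains no closed path of length at least $3$ (no cycle).
   Formalization: Since X may be infinite, "path" here includes one-way and two-way infinite paths; with finite paths only, the claim fails, e.g. for X = {p1p2, p2p3, p3p4, ...}, where B(X) is an infinite ray. For finite components it is the usual finite path. *)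

theory Defs
  imports
    "Graph_Theory.Graph_Theory"
    "HOL-Computational_Algebra.Primes"
begin

text \<open>
  Simple undirected graphs, possibly infinite, are represented as bidirected (symmetric,
  loop-free) digraphs without parallel arcs: an edge is a pair of opposite arcs.
\<close>

definition rho :: "nat set \<Rightarrow> nat set" where
  "rho X = {p. prime p \<and> (\<exists>x\<in>X. p dvd x)}"

definition star :: "nat set \<Rightarrow> nat set" where
  "star X = X - {1}"

text \<open>The two parts are tagged, since a prime may belong to both.\<close>

definition bipartite_divisor_graph :: "nat set \<Rightarrow> (nat + nat) pair_pre_digraph" where
  "bipartite_divisor_graph X =
    \<lparr> pverts = rho X <+> star X,
      parcs = {(Inl p, Inr x) |p x. p \<in> rho X \<and> x \<in> star X \<and> p dvd x}
            \<union> {(Inr x, Inl p) |p x. p \<in> rho X \<and> x \<in> star X \<and> p dvd x} \<rparr>"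

definition prime_vertex_graph :: "nat set \<Rightarrow> nat pair_pre_digraph" where
  "prime_vertex_graph X =
    \<lparr> pverts = rho X,
      parcs = {(p, q). p \<in> rho X \<and> q \<in> rho X \<and> p \<noteq> q \<and> (\<exists>x\<in>X. p * q dvd x)} \<rparr>"

definition common_divisor_graph :: "nat set \<Rightarrow> nat pair_pre_digraph" where
  "common_divisor_graph X =
    \<lparr> pverts = star X,
      parcs = {(x, y). x \<in> star X \<and> y \<in> star X \<and> x \<noteq> y \<and> gcd x y > 1} \<rparr>"

lemma pair_bidirected_bipartite_divisor_graph:
  "pair_bidirected_digraph (bipartite_divisor_graph X)"
  by unfold_locales
    (auto simp: bipartite_divisor_graph_def symmetric_def sym_def)

lemma pair_bidirected_prime_vertex_graph:
  "pair_bidirected_digraph (prime_vertex_graph X)"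
  by unfold_locales
    (auto simp: prime_vertex_graph_def symmetric_def sym_def mult.commute)

lemma pair_bidirected_common_divisor_graph:
  "pair_bidirected_digraph (common_divisor_graph X)"
  by unfold_locales
    (auto simp: common_divisor_graph_def symmetric_def sym_def gcd.commute)

text \<open>
  In a bidirected digraph every edge yields a directed cycle of length 2; the cycles of the
  underlying undirected graph are the directed cycles of length at least 3.
\<close>

definition acyclic_graph :: "('a, 'b) pre_digraph \<Rightarrow> bool" where
  "acyclic_graph G \<longleftrightarrow> \<not> (\<exists>c. pre_digraph.cycle G c \<and> length c \<ge> 3)"

text \<open>In a bidirected digraph the strongly connected components are the connected components.\<close>

definition connected_components :: "('a, 'b) pre_digraph \<Rightarrow> ('a, 'b) pre_digraph set" where
  "connected_components G = pre_digraph.sccs G"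

text \<open>
  A path graph has a non-empty interval of integers as its vertex set, consecutive integers being
  adjacent. An infinite graph may be a one-way or two-way infinite path; a finite one is
  a path in the usual sense.
\<close>

definition path_on :: "int set \<Rightarrow> int pair_pre_digraph" where
  "path_on I = \<lparr> pverts = I, parcs = {(i, j). i \<in> I \<and> j \<in> I \<and> \<bar>i - j\<bar> = 1} \<rparr>"

definition is_path :: "('a, 'b) pre_digraph \<Rightarrow> bool" where
  "is_path G \<longleftrightarrow>
    (\<exists>I. I \<noteq> {} \<and> (\<forall>i\<in>I. \<forall>k\<in>I. {i..k} \<subseteq> I) \<and> digraph_iso G (with_proj (path_on I)))"

lemma is_path_finite:
  assumes "is_path G" and "finite (verts G)"
  shows "\<exists>a b. a \<le> b \<and> digraph_iso G (with_proj (path_on {a..b}))"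
proof -
  obtain I where I: "I \<noteq> {}" "\<forall>i\<in>I. \<forall>k\<in>I. {i..k} \<subseteq> I" "digraph_iso G (with_proj (path_on I))"
    using assms(1) unfolding is_path_def by blast
  obtain f where f: "with_proj (path_on I) = app_iso f G"
    using I(3) unfolding digraph_iso_def by blast
  have "I = verts (with_proj (path_on I))"
    by (simp add: path_on_def)
  also have "\<dots> = iso_verts f ` verts G"
    unfolding f by (simp add: verts_app_iso)
  finally have "finite I"
    using assms(2) by simp
  then have "Min I \<in> I" "Max I \<in> I" "I \<subseteq> {Min I..Max I}"
    using I(1) by auto
  then have "Min I \<le> Max I" "I = {Min I..Max I}"
    using I(2) by (auto simp: subset_antisym)
  then show ?thesis
    using I(3) by metis
qed

definition cycle_on :: "nat \<Rightarrow> nat pair_pre_digraph" where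
  "cycle_on n =
    \<lparr> pverts = {..<n},
      parcs = {(i, j). i < n \<and> j < n \<and> (j = (i + 1) mod n \<or> i = (j + 1) mod n)} \<rparr>"

definition is_cycle_of_length :: "nat \<Rightarrow> ('a, 'b) pre_digraph \<Rightarrow> bool" where
  "is_cycle_of_length n G \<longleftrightarrow> n \<ge> 3 \<and> digraph_iso G (with_proj (cycle_on n))"

end

theory Submission
  imports Defs "HOL-Number_Theory.Cong"
begin

text \<open>
  Two primes are adjacent in \<open>\<Delta>(X)\<close>, and two elements in \<open>\<Gamma>(X)\<close>, exactly when they are distinct
  and have a common neighbour in \<open>B(X)\<close>. So \<open>\<Gamma>(X)\<close> and \<open>\<Delta>(X)\<close> together form the graph \<open>S\<close> that
  joins the vertices at distance two in \<open>B(X)\<close>. Three neighbours of one vertex form a triangle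
  in \<open>S\<close>; if \<open>S\<close> is acyclic, all degrees in \<open>B(X)\<close> are therefore at most two, and every
  component is a path (possibly infinite) or a cycle. Walking around a cycle of length other
  than four in double steps gives a cycle in \<open>S\<close>. Conversely, a cycle in \<open>S\<close> lies over one
  component of \<open>B(X)\<close>. It cannot lie over a path, as its rightmost vertex has only one
  \<open>S\<close>-neighbour to the left, nor over a 4-cycle, where every vertex has only one \<open>S\<close>-neighbour.
\<close>

section \<open>Cycles in relations\<close>

definition simple_cycle :: "'a rel \<Rightarrow> nat \<Rightarrow> (nat \<Rightarrow> 'a) \<Rightarrow> bool" where
  "simple_cycle E n g \<longleftrightarrow> 3 \<le> n \<and> inj_on g {..<n} \<and> (\<forall>i<n. (g i, g (Suc i mod n)) \<in> E)"

definition cycle_free :: "'a rel \<Rightarrow> bool" where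
  "cycle_free E \<longleftrightarrow> (\<nexists>n g. simple_cycle E n g)"

lemma
  assumes "simple_cycle E n g"
  shows simple_cycle_length: "3 \<le> n"
    and simple_cycle_inj_on: "inj_on g {..<n}"
    and simple_cycle_arc: "i < n \<Longrightarrow> (g i, g (Suc i mod n)) \<in> E"
  using assms by (auto simp: simple_cycle_def)

lemma simple_cycle_map:
  assumes "simple_cycle R n g" and "inj_on h (g ` {..<n})"
    and "\<And>u v. u \<in> g ` {..<n} \<Longrightarrow> v \<in> g ` {..<n} \<Longrightarrow> (u, v) \<in> R \<Longrightarrow> (h u, h v) \<in> S"
  shows "simple_cycle S n (h \<circ> g)"
proof -
  have "Suc i mod n < n" if "i < n" for i
    using that by simp
  then show ?thesis
    using assms by (auto simp: simple_cycle_def intro: comp_inj_on)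
qed

lemma simple_cycle_image_subset:
  assumes cycle: "simple_cycle R n g" and "R `` S \<subseteq> S" and "g 0 \<in> S"
  shows "g ` {..<n} \<subseteq> S"
proof -
  have "g i \<in> S" if "i < n" for i
    using that
  proof (induction i)
    case (Suc i)
    then have "(g i, g (Suc i)) \<in> R"
      using simple_cycle_arc[OF cycle, of i] by simp
    then show ?case
      using Suc assms(2) by auto
  qed (use assms(3) in simp)
  then show ?thesis by blast
qed

lemma simple_cycle_two_neighbours:
  assumes cycle: "simple_cycle E n g" and "sym E" and "i < n"
  obtains j k where "j < n" "k < n" "g j \<noteq> g k" "(g i, g j) \<in> E" "(g i, g k) \<in> E"
proof -
  define j where "j = (if i = 0 then n - 1 else i - 1)"
  have pred: "j < n" "Suc j mod n = i" "Suc i mod n < n" "j \<noteq> Suc i mod n"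
    using simple_cycle_length[OF cycle] \<open>i < n\<close> by (auto simp: j_def mod_Suc)
  show thesis
  proof (rule that)
    show "g j \<noteq> g (Suc i mod n)"
      using pred simple_cycle_inj_on[OF cycle] by (auto dest: inj_onD)
    show "(g i, g j) \<in> E"
      using simple_cycle_arc[OF cycle pred(1)] pred(2) \<open>sym E\<close> by (auto dest: symD)
    show "(g i, g (Suc i mod n)) \<in> E"
      using cycle \<open>i < n\<close> by (rule simple_cycle_arc)
  qed (fact pred)+
qed

lemma simple_cycle_triangle:
  assumes "distinct [a, b, c]" and "(a, b) \<in> E" and "(b, c) \<in> E" and "(c, a) \<in> E"
  shows "simple_cycle E 3 ((!) [a, b, c])"
  unfolding simple_cycle_def
proof (intro conjI allI impI)
  show "inj_on ((!) [a, b, c]) {..<3}"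
    using assms(1) by (intro inj_on_nth) auto
  fix i :: nat assume "i < 3"
  then consider "i = 0" | "i = 1" | "i = 2" by linarith
  then show "([a, b, c] ! i, [a, b, c] ! (Suc i mod 3)) \<in> E"
    by cases (use assms(2-) in simp_all)
qed simp

lemma cycle_free_if_unique_lower_neighbour:
  fixes E :: "'a::linorder rel"
  assumes "sym E" and lower: "\<And>a b c. (a, b) \<in> E \<Longrightarrow> (a, c) \<in> E \<Longrightarrow> b \<le> a \<Longrightarrow> c \<le> a \<Longrightarrow> b = c"
  shows "cycle_free E"
  unfolding cycle_free_def
proof (intro notI, elim exE)
  fix n g assume cycle: "simple_cycle E n g"
  let ?M = "Max (g ` {..<n})"
  have "?M \<in> g ` {..<n}"
    using simple_cycle_length[OF cycle] by (intro Max_in) (auto simp: lessThan_empty_iff)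
  then obtain i where i: "i < n" "g i = ?M"
    by auto
  obtain j k where jk: "j < n" "k < n" "g j \<noteq> g k" "(g i, g j) \<in> E" "(g i, g k) \<in> E"
    using simple_cycle_two_neighbours[OF cycle \<open>sym E\<close> i(1)] .
  moreover have "g j \<le> g i" "g k \<le> g i"
    using jk(1,2) by (simp_all add: i(2))
  ultimately show False
    using lower by blast
qed

lemma cycle_free_inv_image:
  assumes "cycle_free R" and "inj f"
  shows "cycle_free (inv_image R f)"
  using assms simple_cycle_map[of "inv_image R f" _ _ f R] inj_on_subset[OF \<open>inj f\<close> subset_UNIV]
  unfolding cycle_free_def in_inv_image by metis

lemma not_cycle_free_inv_image:
  assumes cycle: "simple_cycle R n g" and range: "g ` {..<n} \<subseteq> range f"
  shows "\<not> cycle_free (inv_image R f)"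
proof -
  have "simple_cycle (inv_image R f) n (inv f \<circ> g)"
    using range
    by (intro simple_cycle_map[OF cycle] inj_on_inv_into) (auto simp: f_inv_into_f subset_iff)
  then show ?thesis
    by (auto simp: cycle_free_def)
qed

lemma cycle_free_sum_iff:
  fixes R :: "('a + 'b) rel"
  assumes "R `` range Inl \<subseteq> range Inl" and "R `` range Inr \<subseteq> range Inr"
  shows "cycle_free R \<longleftrightarrow> cycle_free (inv_image R Inl) \<and> cycle_free (inv_image R Inr)"
proof
  assume "cycle_free (inv_image R Inl) \<and> cycle_free (inv_image R Inr)"
  then have "\<not> g ` {..<n} \<subseteq> range Inl" "\<not> g ` {..<n} \<subseteq> range Inr" if "simple_cycle R n g" for n g
    using not_cycle_free_inv_image[OF that] by blast+
  moreover have "g 0 \<in> range Inl \<or> g 0 \<in> range Inr" for g :: "nat \<Rightarrow> 'a + 'b"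
    by (cases "g 0") auto
  ultimately show "cycle_free R"
    using assms simple_cycle_image_subset[of R _ _ "range Inl"]
      simple_cycle_image_subset[of R _ _ "range Inr"]
    unfolding cycle_free_def by blast
qed (simp add: cycle_free_inv_image)

section \<open>Cycles in digraphs\<close>

lemma (in pre_digraph) cas_iff_nth:
  assumes "c \<noteq> []"
  shows "cas u c v \<longleftrightarrow> tail G (hd c) = u \<and> head G (last c) = v \<and>
    (\<forall>i. Suc i < length c \<longrightarrow> head G (c ! i) = tail G (c ! Suc i))"
  using assms
proof (induction c arbitrary: u)
  case (Cons e c)
  show ?case
  proof (cases "c = []")
    case False
    then show ?thesis
      using Cons.IH[OF False, of "head G e"]
      by (auto simp: nth_Cons hd_conv_nth split: nat.splits)
  qed auto
qed simp

lemma (in pre_digraph) ex_closed_cas_iff_nth: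
  assumes "c \<noteq> []"
  shows "(\<exists>u. cas u c u) \<longleftrightarrow>
    (\<forall>i<length c. head G (c ! i) = tail G (c ! (Suc i mod length c)))" (is "_ \<longleftrightarrow> ?R")
proof -
  obtain m where m: "length c = Suc m"
    using assms by (cases c) auto
  have "?R \<longleftrightarrow> head G (c ! m) = tail G (c ! 0) \<and> (\<forall>i<m. head G (c ! i) = tail G (c ! Suc i))"
  proof -
    have "i mod Suc m = i" if "i \<le> m" for i
      using that by simp
    then show ?thesis
      by (auto simp: m less_Suc_eq Suc_le_eq)
  qed
  then show ?thesis
    using assms m by (auto simp: cas_iff_nth last_conv_nth hd_conv_nth)
qed

lemma (in wf_digraph) cycle_iff_nth:
  "cycle c \<longleftrightarrow> c \<noteq> [] \<and> set c \<subseteq> arcs G \<and> distinct (map (head G) c) \<and>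
    (\<forall>i<length c. head G (c ! i) = tail G (c ! (Suc i mod length c)))"
proof (cases "c = []")
  case False
  have "awalk u c u \<and> distinct (tl (awalk_verts u c)) \<longleftrightarrow>
      set c \<subseteq> arcs G \<and> distinct (map (head G) c) \<and> cas u c u" for u
    using False subsetD[OF _ hd_in_set[OF False], of "arcs G"]
    by (auto simp: awalk_def awalk_verts_conv' cas_iff_nth)
  then show ?thesis
    using False ex_closed_cas_iff_nth[OF False] by (auto simp: cycle_def)
qed (simp add: cycle_def)

lemma (in wf_digraph) simple_cycle_if_cycle:
  assumes "cycle c" and "3 \<le> length c"
  shows "simple_cycle (arcs_ends G) (length c) (\<lambda>i. head G (c ! i))"
  unfolding simple_cycle_def
proof (intro conjI allI impI)
  have arcs: "set c \<subseteq> arcs G" and heads: "distinct (map (head G) c)"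
    and step: "\<And>i. i < length c \<Longrightarrow> head G (c ! i) = tail G (c ! (Suc i mod length c))"
    using assms(1) unfolding cycle_iff_nth by blast+
  show "inj_on (\<lambda>i. head G (c ! i)) {..<length c}"
    using heads by (auto simp: inj_on_def distinct_conv_nth)
  fix i assume i: "i < length c"
  then have "c ! (Suc i mod length c) \<in> arcs G"
    using arcs by (metis gr_implies_not0 mod_less_divisor not_gr_zero nth_mem subsetD)
  then show "(head G (c ! i), head G (c ! (Suc i mod length c))) \<in> arcs_ends G"
    using step[OF i] by (auto simp: arcs_ends_conv)
qed (fact assms(2))

lemma (in wf_digraph) ex_cycle_if_simple_cycle:
  assumes cycle: "simple_cycle (arcs_ends G) n g"
  obtains c where "cycle c" and "length c = n"
proof -
  have "\<exists>a. \<forall>i\<in>{..<n}. a i \<in> arcs G \<and> tail G (a i) = g i \<and> head G (a i) = g (Suc i mod n)"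
    using simple_cycle_arc[OF cycle] by (intro bchoice) (fastforce simp: arcs_ends_conv)
  then obtain a where arcs: "\<And>i. i < n \<Longrightarrow> a i \<in> arcs G" "\<And>i. i < n \<Longrightarrow> tail G (a i) = g i"
      "\<And>i. i < n \<Longrightarrow> head G (a i) = g (Suc i mod n)"
    by auto
  have "inj_on (\<lambda>i. g (Suc i mod n)) {..<n}"
  proof (rule inj_onI)
    fix i j assume ij: "i \<in> {..<n}" "j \<in> {..<n}" "g (Suc i mod n) = g (Suc j mod n)"
    then have "Suc i mod n = Suc j mod n"
      using simple_cycle_length[OF cycle] simple_cycle_inj_on[OF cycle] by (auto dest: inj_onD)
    then show "i = j"
      using ij by (auto simp: mod_Suc split: if_splits)
  qed
  then have "inj_on (head G \<circ> a) {..<n}"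
    using arcs(3) by (subst inj_on_cong[where g = "\<lambda>i. g (Suc i mod n)"]) auto
  then have "cycle (map a [0..<n])"
    using simple_cycle_length[OF cycle] arcs
    by (auto simp: cycle_iff_nth distinct_map atLeast0LessThan)
  then show thesis
    by (rule that) simp
qed

lemma (in wf_digraph) acyclic_graph_iff_cycle_free:
  "acyclic_graph G \<longleftrightarrow> cycle_free (arcs_ends G)"
  unfolding acyclic_graph_def cycle_free_def
  using simple_cycle_if_cycle ex_cycle_if_simple_cycle by (metis simple_cycle_length)

section \<open>The square of a graph\<close>

definition square :: "'a rel \<Rightarrow> 'a rel" where
  "square E = {(u, w). u \<noteq> w \<and> (u, w) \<in> E O E}"

lemma sym_square: "sym E \<Longrightarrow> sym (square E)"
  unfolding square_def sym_def by blast

lemma degree_le_two_if_cycle_free_square: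
  assumes "cycle_free (square E)" and "sym E" and "(v, a) \<in> E" "(v, b) \<in> E" "(v, c) \<in> E"
  shows "a = b \<or> a = c \<or> b = c"
proof (rule ccontr)
  assume "\<not> ?thesis"
  moreover from this have "(a, b) \<in> square E" "(b, c) \<in> square E" "(c, a) \<in> square E"
    using assms(3-) assms(3-)[THEN symD[OF \<open>sym E\<close>]] unfolding square_def by blast+
  ultimately have "simple_cycle (square E) 3 ((!) [a, b, c])"
    by (intro simple_cycle_triangle) simp_all
  then show False
    using assms(1) unfolding cycle_free_def by blast
qed

lemma double_mod_eq_iff:
  fixes i j n :: nat
  shows "2 * i mod n = 2 * j mod n \<longleftrightarrow>
    i mod (if even n then n div 2 else n) = j mod (if even n then n div 2 else n)"
proof (cases "even n")
  case True
  then have "n = 2 * (n div 2)" by simp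
  then have "2 * k mod n = 2 * (k mod (n div 2))" for k
    by (metis mod_mult_mult1)
  then show ?thesis
    using True by simp
next
  case False
  then have "[2 * i = 2 * j] (mod n) \<longleftrightarrow> [i = j] (mod n)"
    by (intro cong_mult_lcancel_nat) (simp add: coprime_left_2_iff_odd)
  then show ?thesis
    using False unfolding cong_def by simp
qed

text \<open>Walk around the cycle in steps of length two: this visits all vertices if \<open>n\<close> is odd and
  every other vertex if \<open>n\<close> is even; for \<open>n = 4\<close> the resulting closed walk is too short.\<close>

lemma cycle_free_square_imp_length_4:
  assumes "cycle_free (square E)" and cycle: "simple_cycle E n g"
  shows "n = 4"
proof (rule ccontr)
  note length = simple_cycle_length[OF cycle] and arc = simple_cycle_arc[OF cycle]
  assume "n \<noteq> 4"
  define m where "m = (if even n then n div 2 else n)"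
  define h where "h = (\<lambda>k. g (2 * k mod n))"
  have m: "3 \<le> m"
    using length \<open>n \<noteq> 4\<close> unfolding m_def by (cases "even n") (auto elim!: evenE)
  have h_eq_iff: "h i = h j \<longleftrightarrow> i mod m = j mod m" for i j
    using length inj_on_eq_iff[OF simple_cycle_inj_on[OF cycle], of "2 * i mod n" "2 * j mod n"]
    unfolding h_def m_def by (simp flip: double_mod_eq_iff)
  have "(h k, h (Suc k mod m)) \<in> square E" if "k < m" for k
  proof -
    have "(h k, g (Suc (2 * k) mod n)) \<in> E" "(g (Suc (2 * k) mod n), h (Suc k)) \<in> E"
      using arc[of "2 * k mod n"] arc[of "Suc (2 * k) mod n"] length
      by (simp_all add: h_def mod_Suc_eq)
    moreover have "h (Suc k) = h (Suc k mod m)" "h k \<noteq> h (Suc k)"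
      using that m by (auto simp: h_eq_iff mod_Suc)
    ultimately show ?thesis
      by (auto simp: square_def)
  qed
  moreover have "inj_on h {..<m}"
    by (rule inj_onI) (simp add: h_eq_iff)
  ultimately have "simple_cycle (square E) m h"
    using m by (simp add: simple_cycle_def)
  then show False
    using assms(1) unfolding cycle_free_def by blast
qed

section \<open>Paths and cycles as graphs\<close>

lemma (in pair_sym_digraph) sym_parcs: "sym (parcs G)"
  using pair_sym_arcs by (simp add: symmetric_def)

lemma pair_bidirected_digraphI:
  assumes "parcs G \<subseteq> pverts G \<times> pverts G" and "sym (parcs G)" and "irrefl (parcs G)"
  shows "pair_bidirected_digraph G"
  by unfold_locales (use assms in \<open>auto simp: symmetric_def irrefl_def\<close>)

lemma pair_bidirected_digraph_path_on: "pair_bidirected_digraph (path_on I)"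
  by (rule pair_bidirected_digraphI) (auto simp: path_on_def sym_def irrefl_def)

lemma pair_bidirected_digraph_cycle_on:
  assumes "2 \<le> n"
  shows "pair_bidirected_digraph (cycle_on n)"
proof (rule pair_bidirected_digraphI)
  show "irrefl (parcs (cycle_on n))"
    using assms by (auto simp: cycle_on_def irrefl_def mod_Suc)
qed (auto simp: cycle_on_def sym_def)

lemma cycle_on_arc_iff:
  assumes "k < l" and "l < n"
  shows "(k, l) \<in> parcs (cycle_on n) \<longleftrightarrow> l = Suc k \<or> k = 0 \<and> l = n - 1"
  using assms by (auto simp: cycle_on_def mod_Suc)

lemma simple_cycle_cycle_on:
  assumes "3 \<le> n"
  shows "simple_cycle (parcs (cycle_on n)) n id"
  using assms by (auto simp: simple_cycle_def cycle_on_def)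

lemma cycle_free_square_path_on: "cycle_free (square (parcs (path_on I)))"
proof (rule cycle_free_if_unique_lower_neighbour)
  show "sym (square (parcs (path_on I)))"
    using pair_bidirected_digraph.axioms(1)[OF pair_bidirected_digraph_path_on]
    by (intro sym_square pair_sym_digraph.sym_parcs)
  have distance: "\<bar>a - b\<bar> = 2" if "(a, b) \<in> square (parcs (path_on I))" for a b
    using that unfolding square_def path_on_def by auto
  show "b = c" if "(a, b) \<in> square (parcs (path_on I))" "(a, c) \<in> square (parcs (path_on I))"
      "b \<le> a" "c \<le> a" for a b c
    using distance[OF that(1)] distance[OF that(2)] that(3,4) by linarith
qed

lemma cycle_free_square_cycle_on_4: "cycle_free (square (parcs (cycle_on 4)))"
proof (rule cycle_free_if_unique_lower_neighbour)
  show "sym (square (parcs (cycle_on 4)))"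
    using pair_bidirected_digraph.axioms(1)[OF pair_bidirected_digraph_cycle_on]
    by (intro sym_square pair_sym_digraph.sym_parcs) simp
  have opposite: "b = a + 2 \<or> a = b + 2" if "(a, b) \<in> square (parcs (cycle_on 4))" for a b
  proof -
    from that obtain c where "a \<noteq> b" "a < 4" "b < 4" "c < 4"
      and "c = Suc a mod 4 \<or> a = Suc c mod 4" "b = Suc c mod 4 \<or> c = Suc b mod 4"
      unfolding square_def cycle_on_def by auto
    then show ?thesis
      by (auto simp: mod_Suc split: if_splits)
  qed
  show "b = c" if "(a, b) \<in> square (parcs (cycle_on 4))" "(a, c) \<in> square (parcs (cycle_on 4))"
      "b \<le> a" "c \<le> a" for a b c
    using opposite[OF that(1)] opposite[OF that(2)] that(3,4) by linarith
qed

section \<open>Components and isomorphisms\<close>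

definition restrict_pair :: "'a pair_pre_digraph \<Rightarrow> 'a set \<Rightarrow> 'a pair_pre_digraph" where
  "restrict_pair G S = \<lparr>pverts = S, parcs = parcs G \<inter> S \<times> S\<rparr>"

lemma with_proj_restrict_pair: "with_proj (restrict_pair G S) = with_proj G \<restriction> S"
  by (auto simp: induce_subgraph_def with_proj_def restrict_pair_def)

lemma (in pair_bidirected_digraph) irrefl_parcs: "irrefl (parcs G)"
  using pair_no_loops by (force simp: irrefl_def)

lemma (in pair_bidirected_digraph) pair_bidirected_digraph_restrict_pair:
  "pair_bidirected_digraph (restrict_pair G S)"
proof (rule pair_bidirected_digraphI)
  show "sym (parcs (restrict_pair G S))"
    using sym_parcs by (auto simp: restrict_pair_def sym_def)
  show "irrefl (parcs (restrict_pair G S))"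
    using irrefl_parcs by (auto simp: restrict_pair_def irrefl_def)
qed (simp add: restrict_pair_def)

lemma (in sym_digraph) connected_components_eq:
  "connected_components G = (\<lambda>v. G \<restriction> ((arcs_ends G)\<^sup>* `` {v})) ` verts G"
proof -
  have "scc_of v = (arcs_ends G)\<^sup>* `` {v}" if "v \<in> verts G" for v
    using that symmetric_reachable' by (auto simp: scc_of_def reachable_conv')
  then show ?thesis
    by (simp add: connected_components_def sccs_conv_sccs_verts sccs_verts_conv_scc_of image_image)
qed

definition pair_component :: "'a pair_pre_digraph \<Rightarrow> 'a \<Rightarrow> 'a pair_pre_digraph" where
  "pair_component G v = restrict_pair G ((parcs G)\<^sup>* `` {v})"

lemma (in pair_sym_digraph) connected_components_eq_pair_component:
  "connected_components (with_proj G) = (\<lambda>v. with_proj (pair_component G v)) ` pverts G"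
  using connected_components_eq by (simp add: pair_component_def with_proj_restrict_pair)

lemma (in pair_bidirected_digraph) pair_bidirected_digraph_pair_component:
  "pair_bidirected_digraph (pair_component G v)"
  unfolding pair_component_def by (rule pair_bidirected_digraph_restrict_pair)

lemma digraph_iso_with_projD:
  assumes "pair_wf_digraph G" and "digraph_iso (with_proj G) (with_proj H)"
  obtains f where "inj_on f (pverts G)" and "\<And>u v. (u, v) \<in> parcs G \<Longrightarrow> (f u, f v) \<in> parcs H"
proof -
  interpret G: pair_wf_digraph G by fact
  obtain \<phi> where iso: "G.digraph_isomorphism \<phi>" and H: "with_proj H = app_iso \<phi> (with_proj G)"
    using assms(2) unfolding digraph_iso_def by blast
  have "parcs H = iso_arcs \<phi> ` parcs G" "iso_tail \<phi> = fst" "iso_head \<phi> = snd"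
    using H by (simp_all add: with_proj_def app_iso_def)
  then have "(iso_verts \<phi> u, iso_verts \<phi> v) \<in> parcs H" if "(u, v) \<in> parcs G" for u v
    using iso that unfolding G.digraph_isomorphism_def
    by (metis fst_conv image_eqI prod.collapse snd_conv)
  moreover have "inj_on (iso_verts \<phi>) (pverts G)"
    using iso by (simp add: G.digraph_isomorphism_def)
  ultimately show thesis
    using that by blast
qed

lemma digraph_iso_with_projI:
  assumes "pair_wf_digraph G" and "pair_wf_digraph H" and bij: "bij_betw f (pverts G) (pverts H)"
    and arcs: "\<And>u v. u \<in> pverts G \<Longrightarrow> v \<in> pverts G \<Longrightarrow> (u, v) \<in> parcs G \<longleftrightarrow> (f u, f v) \<in> parcs H"
  shows "digraph_iso (with_proj G) (with_proj H)"
proof -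
  interpret G: pair_wf_digraph G by fact
  interpret H: pair_wf_digraph H by fact
  define \<phi> where "\<phi> = \<lparr>iso_verts = f, iso_arcs = map_prod f f, iso_head = snd, iso_tail = fst\<rparr>"
  have sub: "parcs G \<subseteq> pverts G \<times> pverts G" "parcs H \<subseteq> pverts H \<times> pverts H"
    by (auto dest: G.in_arcsD1 G.in_arcsD2 H.in_arcsD1 H.in_arcsD2)
  have "parcs H = map_prod f f ` parcs G"
  proof
    show "map_prod f f ` parcs G \<subseteq> parcs H"
      using sub(1) arcs by auto
    show "parcs H \<subseteq> map_prod f f ` parcs G"
    proof (rule subrelI)
      fix u' v' assume "(u', v') \<in> parcs H"
      moreover from this obtain u v where "u \<in> pverts G" "v \<in> pverts G" "u' = f u" "v' = f v"
        using sub(2) bij_betw_imp_surj_on[OF bij] by blast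
      ultimately show "(u', v') \<in> map_prod f f ` parcs G"
        using arcs by force
    qed
  qed
  then have "with_proj H = app_iso \<phi> (with_proj G)"
    using bij_betw_imp_surj_on[OF bij] by (simp add: with_proj_def app_iso_def \<phi>_def)
  moreover have "inj_on (map_prod f f) (parcs G)"
    using map_prod_inj_on[OF bij_betw_imp_inj_on[OF bij] bij_betw_imp_inj_on[OF bij]] sub(1)
    by (rule inj_on_subset)
  then have "G.digraph_isomorphism \<phi>"
    using bij_betw_imp_inj_on[OF bij] G.wf_digraph_axioms
    by (auto simp: G.digraph_isomorphism_def \<phi>_def)
  ultimately show ?thesis
    unfolding digraph_iso_def by blast
qed

lemma digraph_iso_with_proj_linorderI:
  fixes G :: "'a::linorder pair_pre_digraph"
  assumes "pair_bidirected_digraph G" and "pair_bidirected_digraph H"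
    and bij: "bij_betw f (pverts G) (pverts H)"
    and less_iff: "\<And>u v. u \<in> pverts G \<Longrightarrow> v \<in> pverts G \<Longrightarrow> u < v \<Longrightarrow>
      (u, v) \<in> parcs G \<longleftrightarrow> (f u, f v) \<in> parcs H"
  shows "digraph_iso (with_proj G) (with_proj H)"
proof (rule digraph_iso_with_projI[OF _ _ bij])
  interpret G: pair_bidirected_digraph G by fact
  interpret H: pair_bidirected_digraph H by fact
  show "pair_wf_digraph G" "pair_wf_digraph H" ..
  fix u v assume uv: "u \<in> pverts G" "v \<in> pverts G"
  show "(u, v) \<in> parcs G \<longleftrightarrow> (f u, f v) \<in> parcs H"
  proof (cases u v rule: linorder_cases)
    case less
    then show ?thesis
      using less_iff[OF uv] by simp
  next
    case equal
    then show ?thesis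
      using G.irrefl_parcs H.irrefl_parcs by (simp add: irrefl_def)
  next
    case greater
    then show ?thesis
      using less_iff[OF uv(2,1)] G.sym_parcs H.sym_parcs by (meson symD)
  qed
qed

lemma cycle_free_square_iso:
  assumes "pair_wf_digraph G" and "digraph_iso (with_proj G) (with_proj H)"
    and "cycle_free (square (parcs H))"
  shows "cycle_free (square (parcs G))"
  unfolding cycle_free_def
proof (intro notI, elim exE)
  interpret G: pair_wf_digraph G by fact
  fix n g assume cycle: "simple_cycle (square (parcs G)) n g"
  obtain f where inj: "inj_on f (pverts G)"
    and arcs: "\<And>u v. (u, v) \<in> parcs G \<Longrightarrow> (f u, f v) \<in> parcs H"
    using digraph_iso_with_projD[OF assms(1,2)] by blast
  have verts: "u \<in> pverts G \<and> w \<in> pverts G" if "(u, w) \<in> square (parcs G)" for u w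
    using that by (auto simp: square_def dest: G.in_arcsD1 G.in_arcsD2)
  have "(f u, f w) \<in> square (parcs H)" if uw: "(u, w) \<in> square (parcs G)" for u w
  proof -
    have "f u \<noteq> f w"
      using inj_onD[OF inj] verts[OF uw] uw unfolding square_def by blast
    moreover have "(f u, f w) \<in> parcs H O parcs H"
      using uw arcs unfolding square_def by blast
    ultimately show ?thesis
      by (simp add: square_def)
  qed
  moreover have "g ` {..<n} \<subseteq> pverts G"
    using simple_cycle_arc[OF cycle] verts by blast
  ultimately have "simple_cycle (square (parcs H)) n (f \<circ> g)"
    using inj_on_subset[OF inj] by (intro simple_cycle_map[OF cycle]) simp_all
  then show False
    using assms(3) unfolding cycle_free_def by blast
qed

section \<open>Maximal paths\<close>

definition int_path :: "'a rel \<Rightarrow> int set \<Rightarrow> (int \<Rightarrow> 'a) \<Rightarrow> bool" where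
  "int_path E I f \<longleftrightarrow> (\<forall>i\<in>I. \<forall>k\<in>I. {i..k} \<subseteq> I) \<and> inj_on f I \<and>
    (\<forall>i\<in>I. i + 1 \<in> I \<longrightarrow> (f i, f (i + 1)) \<in> E)"

lemma
  assumes "int_path E I f"
  shows int_path_convex: "i \<in> I \<Longrightarrow> k \<in> I \<Longrightarrow> {i..k} \<subseteq> I"
    and int_path_inj_on: "inj_on f I"
    and int_path_arc: "i \<in> I \<Longrightarrow> i + 1 \<in> I \<Longrightarrow> (f i, f (i + 1)) \<in> E"
  using assms unfolding int_path_def by blast+

lemma interval_insert_adjacent:
  fixes I :: "int set"
  assumes convex: "\<And>i k. i \<in> I \<Longrightarrow> k \<in> I \<Longrightarrow> {i..k} \<subseteq> I" and "b \<in> I" and "\<bar>c - b\<bar> = 1"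
    and "i \<in> insert c I" and "k \<in> insert c I"
  shows "{i..k} \<subseteq> insert c I"
proof -
  have "{j..c} \<subseteq> insert c I" "{c..j} \<subseteq> insert c I" if "j \<in> I" for j
  proof -
    have "{j..c} \<subseteq> insert c {j..b}" "{c..j} \<subseteq> insert c {b..j}"
      using \<open>\<bar>c - b\<bar> = 1\<close> by auto
    then show "{j..c} \<subseteq> insert c I" "{c..j} \<subseteq> insert c I"
      using convex[OF that \<open>b \<in> I\<close>] convex[OF \<open>b \<in> I\<close> that] by blast+
  qed
  then show ?thesis
    using assms(4,5) convex[of i k] by (cases "i = c"; cases "k = c") auto
qed

lemma int_path_fun_upd:
  assumes path: "int_path E I f" and "sym E"
    and "b \<in> I" and adjacent: "\<bar>c - b\<bar> = 1" and "c \<notin> I"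
    and arc: "(f b, w) \<in> E" and "w \<notin> f ` I"
  shows "int_path E (insert c I) (f(c := w))"
  unfolding int_path_def
proof (intro conjI ballI impI)
  note convex = int_path_convex[OF path]
  show "{i..k} \<subseteq> insert c I" if "i \<in> insert c I" "k \<in> insert c I" for i k
    using convex \<open>b \<in> I\<close> adjacent that by (rule interval_insert_adjacent)
  show "inj_on (f(c := w)) (insert c I)"
    using int_path_inj_on[OF path] \<open>c \<notin> I\<close> \<open>w \<notin> f ` I\<close> by (auto simp: inj_on_def)
  have only_b: "j = b" if "j \<in> I" "\<bar>c - j\<bar> = 1" for j
  proof (rule ccontr)
    assume "j \<noteq> b"
    then have "c \<in> {b..j} \<or> c \<in> {j..b}"
      using adjacent that(2) by auto
    then show False
      using convex[OF that(1) \<open>b \<in> I\<close>] convex[OF \<open>b \<in> I\<close> that(1)] \<open>c \<notin> I\<close> by blast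
  qed
  fix i assume "i \<in> insert c I" "i + 1 \<in> insert c I"
  then consider (first) "i = c" "i + 1 \<in> I" | (last) "i \<in> I" "i + 1 = c"
    | (inner) "i \<in> I" "i + 1 \<in> I" "i \<noteq> c" "i + 1 \<noteq> c"
    using \<open>c \<notin> I\<close> by auto
  then show "((f(c := w)) i, (f(c := w)) (i + 1)) \<in> E"
  proof cases
    case first
    then show ?thesis
      using only_b[of "i + 1"] symD[OF \<open>sym E\<close> arc] by auto
  next
    case last
    then show ?thesis
      using only_b[of i] arc by auto
  next
    case inner
    then show ?thesis
      using int_path_arc[OF path] by auto
  qed
qed

lemma int_path_rtrancl:
  assumes path: "int_path E I f" and "sym E" and "i \<in> I" and "j \<in> I"
  shows "(f i, f j) \<in> E\<^sup>*"
proof -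
  have forward: "(f a, f b) \<in> E\<^sup>*" if "a \<le> b" "a \<in> I" "b \<in> I" for a b
    using that
  proof (induction b rule: int_ge_induct)
    case (step b)
    then have "b \<in> I"
      using int_path_convex[OF path, of a "b + 1"] by auto
    then show ?case
      using rtrancl_into_rtrancl[OF step.IH int_path_arc[OF path]] step.prems by blast
  qed simp
  then show ?thesis
    using assms(3,4) forward[of i j] symD[OF sym_rtrancl[OF \<open>sym E\<close>] forward[of j i]]
    by (cases "i \<le> j") auto
qed

text \<open>Paths are encoded by their function graphs, so that Zorn's lemma for inclusion
  yields a maximal one.\<close>

definition fun_graph :: "'a set \<Rightarrow> ('a \<Rightarrow> 'b) \<Rightarrow> ('a \<times> 'b) set" where
  "fun_graph A f = (\<lambda>x. (x, f x)) ` A"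

lemma fun_graph_subset_iff: "fun_graph A f \<subseteq> fun_graph B g \<longleftrightarrow> A \<subseteq> B \<and> (\<forall>x\<in>A. f x = g x)"
  by (auto simp: fun_graph_def)

lemma fun_graph_Domain_The:
  assumes "single_valued R"
  shows "fun_graph (Domain R) (\<lambda>x. THE y. (x, y) \<in> R) = R"
proof -
  have "(THE y'. (x, y') \<in> R) = y" if "(x, y) \<in> R" for x y
    using that single_valuedD[OF assms] by blast
  then show ?thesis
    by (force simp: fun_graph_def)
qed

lemma int_path_chain_common_path:
  assumes chain: "subset.chain {fun_graph I f |I f. int_path E I f} \<C>"
    and "p \<in> \<Union>\<C>" and "q \<in> \<Union>\<C>"
  obtains I f where "int_path E I f" and "fun_graph I f \<subseteq> \<Union>\<C>" and "{p, q} \<subseteq> fun_graph I f"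
proof -
  have "finite {p, q}"
    by simp
  moreover have "{p, q} \<subseteq> \<Union>\<C>" "\<C> \<noteq> {}"
    using assms(2,3) by blast+
  ultimately obtain R where "R \<in> \<C>" "{p, q} \<subseteq> R"
    using chain by (rule finite_subset_Union_chain)
  moreover from \<open>R \<in> \<C>\<close> obtain I f where "int_path E I f" "R = fun_graph I f"
    using chain unfolding subset_chain_def by blast
  ultimately show thesis
    using that by blast
qed

lemma int_path_Union_chain:
  assumes chain: "subset.chain {fun_graph I f |I f. int_path E I f} \<C>"
  obtains J g where "int_path E J g" and "fun_graph J g = \<Union>\<C>"
proof -
  have "single_valued (\<Union>\<C>)"
  proof (rule single_valuedI)
    show "u = w" if "(i, u) \<in> \<Union>\<C>" "(i, w) \<in> \<Union>\<C>" for i u w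
      using int_path_chain_common_path[OF chain that] by (auto simp: fun_graph_def)
  qed
  then obtain J g where graph: "fun_graph J g = \<Union>\<C>"
    using fun_graph_Domain_The by blast
  have subpath: "\<exists>I. int_path E I g \<and> I \<subseteq> J \<and> i \<in> I \<and> j \<in> I" if "i \<in> J" "j \<in> J" for i j
  proof -
    have "(i, g i) \<in> \<Union>\<C>" "(j, g j) \<in> \<Union>\<C>"
      using that unfolding graph[symmetric] by (simp_all add: fun_graph_def)
    with chain obtain I f where path: "int_path E I f" and "fun_graph I f \<subseteq> fun_graph J g"
      and "{(i, g i), (j, g j)} \<subseteq> fun_graph I f"
      unfolding graph by (rule int_path_chain_common_path)
    moreover from this(3) have "i \<in> I" "j \<in> I"
      by (auto simp: fun_graph_def)
    moreover from \<open>fun_graph I f \<subseteq> fun_graph J g\<close> have "int_path E I g"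
      using path unfolding fun_graph_subset_iff int_path_def by (simp cong: inj_on_cong)
    ultimately show ?thesis
      unfolding fun_graph_subset_iff by blast
  qed
  have "int_path E J g"
    unfolding int_path_def
  proof (intro conjI ballI impI inj_onI)
    show "{i..k} \<subseteq> J" if "i \<in> J" "k \<in> J" for i k
      using subpath[OF that] int_path_convex by (metis subset_trans)
    show "i = j" if "i \<in> J" "j \<in> J" "g i = g j" for i j
      using subpath[OF that(1,2)] that(3) int_path_inj_on by (metis inj_onD)
    show "(g i, g (i + 1)) \<in> E" if "i \<in> J" "i + 1 \<in> J" for i
      using subpath[OF that] int_path_arc by metis
  qed
  then show thesis
    using graph by (rule that)
qed

definition maximal_int_path :: "'a rel \<Rightarrow> int set \<Rightarrow> (int \<Rightarrow> 'a) \<Rightarrow> bool" where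
  "maximal_int_path E I f \<longleftrightarrow> int_path E I f \<and>
    (\<forall>J g. int_path E J g \<longrightarrow> I \<subseteq> J \<longrightarrow> (\<forall>i\<in>I. f i = g i) \<longrightarrow> J = I)"

lemma maximal_int_pathI_fun_graph:
  assumes "int_path E I f"
    and max: "\<And>J g. int_path E J g \<Longrightarrow> fun_graph I f \<subseteq> fun_graph J g \<Longrightarrow> fun_graph J g = fun_graph I f"
  shows "maximal_int_path E I f"
  unfolding maximal_int_path_def
proof (intro conjI allI impI)
  fix J g assume "int_path E J g" "I \<subseteq> J" "\<forall>i\<in>I. f i = g i"
  then have "fun_graph J g = fun_graph I f"
    by (intro max) (simp_all add: fun_graph_subset_iff)
  then have "J \<subseteq> I"
    using fun_graph_subset_iff[of J g I f] by simp
  then show "J = I"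
    using \<open>I \<subseteq> J\<close> by (rule subset_antisym)
qed (fact assms(1))

lemma ex_maximal_int_path:
  obtains I f where "maximal_int_path E I f" and "v \<in> f ` I"
proof -
  let ?paths = "{fun_graph I f |I f. int_path E I f}"
  define \<A> where "\<A> = {R \<in> ?paths. (0, v) \<in> R}"
  have \<A>I: "fun_graph I f \<in> \<A>" if "int_path E I f" "(0, v) \<in> fun_graph I f" for I f
    unfolding \<A>_def using that by blast
  have "\<exists>R\<in>\<A>. \<forall>Q\<in>\<A>. R \<subseteq> Q \<longrightarrow> Q = R"
  proof (rule subset_Zorn_nonempty)
    have "fun_graph {0} (\<lambda>_. v) \<in> \<A>"
      by (rule \<A>I) (simp_all add: int_path_def fun_graph_def)
    then show "\<A> \<noteq> {}"
      by blast
    fix \<C> assume \<C>: "\<C> \<noteq> {}" "subset.chain \<A> \<C>"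
    then have "subset.chain ?paths \<C>" and "(0, v) \<in> \<Union>\<C>"
      unfolding subset_chain_def \<A>_def by blast+
    moreover from this(1) obtain J g where "int_path E J g" "fun_graph J g = \<Union>\<C>"
      by (rule int_path_Union_chain)
    ultimately show "\<Union>\<C> \<in> \<A>"
      using \<A>I[of J g] by simp
  qed
  then obtain R where "R \<in> \<A>" and max: "\<And>Q. Q \<in> \<A> \<Longrightarrow> R \<subseteq> Q \<Longrightarrow> Q = R"
    by blast
  from \<open>R \<in> \<A>\<close> obtain I f where path: "int_path E I f" and R: "R = fun_graph I f"
    and start: "(0, v) \<in> fun_graph I f"
    unfolding \<A>_def by blast
  have "maximal_int_path E I f"
  proof (rule maximal_int_pathI_fun_graph[OF path])
    show "fun_graph J g = fun_graph I f" if "int_path E J g" "fun_graph I f \<subseteq> fun_graph J g" for J g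
      using max[OF \<A>I[OF that(1)]] that(2) R start by blast
  qed
  moreover have "v \<in> f ` I"
    using start by (auto simp: fun_graph_def)
  ultimately show thesis
    by (rule that)
qed

section \<open>Graphs of maximum degree two\<close>

locale max_degree_two = pair_bidirected_digraph +
  assumes degree_le_two:
    "(v, a) \<in> parcs G \<Longrightarrow> (v, b) \<in> parcs G \<Longrightarrow> (v, c) \<in> parcs G \<Longrightarrow> a = b \<or> a = c \<or> b = c"

locale max_degree_two_path = max_degree_two +
  fixes I :: "int set" and f :: "int \<Rightarrow> 'a"
  assumes maximal: "maximal_int_path (parcs G) I f"
begin

lemma path: "int_path (parcs G) I f"
  using maximal unfolding maximal_int_path_def by blast

lemma neighbour_of_end:
  assumes "i \<in> I" and "\<bar>j - i\<bar> = 1" and "j \<notin> I" and "(f i, w) \<in> parcs G"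
  shows "w \<in> f ` I"
proof (rule ccontr)
  assume "w \<notin> f ` I"
  then have "int_path (parcs G) (insert j I) (f(j := w))"
    by (rule int_path_fun_upd[OF path sym_parcs assms])
  moreover have "I \<subseteq> insert j I" "\<forall>k\<in>I. f k = (f(j := w)) k"
    using assms(3) by auto
  ultimately have "insert j I = I"
    using maximal unfolding maximal_int_path_def by blast
  then show False
    using assms(3) by blast
qed

lemma neighbour_of_interior:
  assumes "i - 1 \<in> I" and "i + 1 \<in> I" and "(f i, w) \<in> parcs G"
  shows "w = f (i - 1) \<or> w = f (i + 1)"
proof -
  have "i \<in> I"
    using int_path_convex[OF path assms(1,2)] by auto
  then have "(f i, f (i - 1)) \<in> parcs G" "(f i, f (i + 1)) \<in> parcs G"
    using int_path_arc[OF path, of "i - 1"] int_path_arc[OF path, of i] assms(1,2) sym_parcs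
    by (auto dest: symD)
  moreover have "f (i - 1) \<noteq> f (i + 1)"
    using inj_onD[OF int_path_inj_on[OF path]] assms(1,2) by fastforce
  ultimately show ?thesis
    using degree_le_two assms(3) by blast
qed

lemma image_closed: "parcs G `` f ` I \<subseteq> f ` I"
proof clarify
  fix i w assume i: "i \<in> I" "(f i, w) \<in> parcs G"
  show "w \<in> f ` I"
  proof (cases "i - 1 \<in> I \<and> i + 1 \<in> I")
    case True
    then show ?thesis
      using neighbour_of_interior[OF _ _ i(2)] by blast
  next
    case False
    then show ?thesis
      using neighbour_of_end[OF i(1) _ _ i(2), of "i - 1"]
        neighbour_of_end[OF i(1) _ _ i(2), of "i + 1"] by auto
  qed
qed

lemma image_eq_component:
  assumes "v \<in> f ` I"
  shows "f ` I = (parcs G)\<^sup>* `` {v}"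
proof
  show "f ` I \<subseteq> (parcs G)\<^sup>* `` {v}"
    using int_path_rtrancl[OF path sym_parcs] assms by auto
  have "(parcs G)\<^sup>* `` {v} \<subseteq> (parcs G)\<^sup>* `` f ` I"
    using assms by blast
  then show "(parcs G)\<^sup>* `` {v} \<subseteq> f ` I"
    using Image_closed_trancl[OF image_closed] by simp
qed

definition chord :: "int \<Rightarrow> int \<Rightarrow> bool" where
  "chord i j \<longleftrightarrow> i \<in> I \<and> j \<in> I \<and> i + 1 < j \<and> (f i, f j) \<in> parcs G"

lemma chord_maximal:
  assumes "chord i j"
  shows "i - 1 \<notin> I" and "j + 1 \<notin> I"
proof -
  have ij: "i \<in> I" "j \<in> I" "i + 1 < j" and arc: "(f i, f j) \<in> parcs G"
    using assms by (simp_all add: chord_def)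
  note eq_iff = inj_on_eq_iff[OF int_path_inj_on[OF path]]
  have between: "i + 1 \<in> I" "j - 1 \<in> I"
    using int_path_convex[OF path ij(1,2)] ij(3) by auto
  show "i - 1 \<notin> I"
  proof
    assume "i - 1 \<in> I"
    then have "j = i - 1 \<or> j = i + 1"
      using neighbour_of_interior[OF _ between(1) arc] between(1) ij(2) by (simp add: eq_iff)
    then show False
      using ij(3) by auto
  qed
  show "j + 1 \<notin> I"
  proof
    assume "j + 1 \<in> I"
    then have "i = j - 1 \<or> i = j + 1"
      using neighbour_of_interior[OF between(2) _ symD[OF sym_parcs arc]] between(2) ij(1)
      by (simp add: eq_iff)
    then show False
      using ij(3) by auto
  qed
qed

lemma chord_joins_ends:
  assumes "chord i j"
  shows "I = {i..j}"
proof -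
  have ij: "i \<in> I" "j \<in> I"
    using assms by (simp_all add: chord_def)
  have "i \<le> k" "k \<le> j" if "k \<in> I" for k
  proof -
    have "i - 1 \<notin> {k..i}" "j + 1 \<notin> {j..k}"
      using chord_maximal[OF assms] int_path_convex[OF path that ij(1)]
        int_path_convex[OF path ij(2) that] by blast+
    then show "i \<le> k" "k \<le> j"
      by simp_all
  qed
  then show ?thesis
    using int_path_convex[OF path ij] by auto
qed

lemma iso_path_on:
  assumes no_chord: "\<nexists>i j. chord i j"
  shows "digraph_iso (with_proj (path_on I)) (with_proj (restrict_pair G (f ` I)))"
proof (rule digraph_iso_with_proj_linorderI[where f = f])
  show "bij_betw f (pverts (path_on I)) (pverts (restrict_pair G (f ` I)))"
    using int_path_inj_on[OF path] by (simp add: path_on_def restrict_pair_def inj_on_imp_bij_betw)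
  show "(i, j) \<in> parcs (path_on I) \<longleftrightarrow> (f i, f j) \<in> parcs (restrict_pair G (f ` I))"
    if "i \<in> pverts (path_on I)" "j \<in> pverts (path_on I)" "i < j" for i j
  proof -
    have mem: "i \<in> I" "j \<in> I"
      using that(1,2) by (simp_all add: path_on_def)
    then have "(f i, f j) \<in> parcs G \<longleftrightarrow> j = i + 1"
      using no_chord int_path_arc[OF path, of i] that(3) unfolding chord_def by force
    then show ?thesis
      using mem that(3) by (auto simp: path_on_def restrict_pair_def)
  qed
qed (fact pair_bidirected_digraph_path_on pair_bidirected_digraph_restrict_pair)+

lemma arc_iff_if_chord:
  assumes chord: "chord a b" and ij: "i \<in> I" "j \<in> I" "i < j"
  shows "(f i, f j) \<in> parcs G \<longleftrightarrow> j = i + 1 \<or> i = a \<and> j = b"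
proof
  assume arc: "(f i, f j) \<in> parcs G"
  show "j = i + 1 \<or> i = a \<and> j = b"
  proof (cases "j = i + 1")
    case False
    then have "chord i j"
      using ij arc by (simp add: chord_def)
    then have "{i..j} = {a..b}"
      using chord_joins_ends[OF chord] chord_joins_ends by metis
    then show ?thesis
      using ij(3) by (auto simp: Icc_eq_Icc)
  qed simp
next
  assume "j = i + 1 \<or> i = a \<and> j = b"
  then show "(f i, f j) \<in> parcs G"
    using int_path_arc[OF path] chord ij(1,2) unfolding chord_def by blast
qed

lemma iso_cycle_on:
  assumes chord: "chord a b"
  obtains n where "3 \<le> n"
    and "digraph_iso (with_proj (cycle_on n)) (with_proj (restrict_pair G (f ` I)))"
proof -
  define n where "n = nat (b - a + 1)"
  define h where "h k = f (a + int k)" for k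
  have n: "3 \<le> n" "b = a + int n - 1"
    using chord by (auto simp: n_def chord_def)
  have shift: "bij_betw (\<lambda>k. a + int k) {..<n} I"
    unfolding chord_joins_ends[OF chord] using n
    by (intro bij_betw_byWitness[where f' = "\<lambda>i. nat (i - a)"]) auto
  have "digraph_iso (with_proj (cycle_on n)) (with_proj (restrict_pair G (f ` I)))"
  proof (rule digraph_iso_with_proj_linorderI[where f = h])
    have "bij_betw h {..<n} (f ` I)"
      using bij_betw_trans[OF shift inj_on_imp_bij_betw[OF int_path_inj_on[OF path]]]
      unfolding h_def comp_def .
    then show "bij_betw h (pverts (cycle_on n)) (pverts (restrict_pair G (f ` I)))"
      by (simp add: cycle_on_def restrict_pair_def)
    fix k l assume "k \<in> pverts (cycle_on n)" "l \<in> pverts (cycle_on n)" and "k < l"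
    then have kl: "k < l" "l < n" and mem: "a + int k \<in> I" "a + int l \<in> I"
      using bij_betwE[OF shift] by (auto simp: cycle_on_def)
    have "(h k, h l) \<in> parcs G \<longleftrightarrow> l = Suc k \<or> k = 0 \<and> l = n - 1"
      using arc_iff_if_chord[OF chord mem] kl n by (auto simp: h_def)
    then show "(k, l) \<in> parcs (cycle_on n) \<longleftrightarrow> (h k, h l) \<in> parcs (restrict_pair G (f ` I))"
      using cycle_on_arc_iff[OF kl] mem by (auto simp: restrict_pair_def h_def)
  qed (use n(1) pair_bidirected_digraph_cycle_on pair_bidirected_digraph_restrict_pair in auto)
  with n(1) show thesis
    by (rule that)
qed

end

lemma (in max_degree_two) component_path_or_cycle:
  assumes "C \<in> connected_components (with_proj G)"
  shows "is_path C \<or> (\<exists>n. is_cycle_of_length n C)"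
proof -
  obtain v where v: "C = with_proj (pair_component G v)"
    using assms unfolding connected_components_eq_pair_component by blast
  obtain I f where maximal: "maximal_int_path (parcs G) I f" and "v \<in> f ` I"
    by (rule ex_maximal_int_path)
  interpret max_degree_two_path G I f
    by unfold_locales (fact maximal)
  have C: "C = with_proj (restrict_pair G (f ` I))"
    unfolding v pair_component_def image_eq_component[OF \<open>v \<in> f ` I\<close>] ..
  show ?thesis
  proof (cases "\<exists>a b. chord a b")
    case True
    then obtain n where n: "3 \<le> n" "digraph_iso (with_proj (cycle_on n)) C"
      using iso_cycle_on unfolding C by metis
    interpret cycle_on: pair_bidirected_digraph "cycle_on n"
      using n(1) by (intro pair_bidirected_digraph_cycle_on) simp
    show ?thesis
      using n digraph_iso_swap[OF cycle_on.wf_digraph_axioms n(2)]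
      unfolding is_cycle_of_length_def by blast
  next
    case False
    interpret path_on: pair_bidirected_digraph "path_on I"
      by (rule pair_bidirected_digraph_path_on)
    have "digraph_iso (with_proj (path_on I)) C"
      unfolding C using False by (rule iso_path_on)
    then have "digraph_iso C (with_proj (path_on I))"
      by (rule digraph_iso_swap[OF path_on.wf_digraph_axioms])
    moreover have "I \<noteq> {}" "\<forall>i\<in>I. \<forall>k\<in>I. {i..k} \<subseteq> I"
      using \<open>v \<in> f ` I\<close> int_path_convex[OF path] by auto
    ultimately show ?thesis
      unfolding is_path_def by blast
  qed
qed

section \<open>Graphs with a cycle-free square\<close>

lemma is_cycle_of_length_imp_simple_cycle:
  assumes "pair_wf_digraph G" and "is_cycle_of_length n (with_proj G)"
  obtains g where "simple_cycle (parcs G) n g"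
proof -
  interpret G: pair_wf_digraph G by fact
  have length: "3 \<le> n" and iso: "digraph_iso (with_proj G) (with_proj (cycle_on n))"
    using assms(2) by (simp_all add: is_cycle_of_length_def)
  interpret cycle: pair_bidirected_digraph "cycle_on n"
    using length by (intro pair_bidirected_digraph_cycle_on) simp
  obtain f where hom: "inj_on f (pverts (cycle_on n))"
      "\<And>u v. (u, v) \<in> parcs (cycle_on n) \<Longrightarrow> (f u, f v) \<in> parcs G"
    using digraph_iso_with_projD[OF cycle.pair_wf_digraph_axioms
        digraph_iso_swap[OF G.wf_digraph_axioms iso]] by blast
  have "simple_cycle (parcs G) n (f \<circ> id)"
    using hom
    by (intro simple_cycle_map[OF simple_cycle_cycle_on[OF length]]) (auto simp: cycle_on_def)
  then show thesis
    by (rule that)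
qed

context pair_bidirected_digraph
begin

lemma component_path_or_four_cycle:
  assumes cycle_free: "cycle_free (square (parcs G))"
    and component: "C \<in> connected_components (with_proj G)"
  shows "is_path C \<or> is_cycle_of_length 4 C"
proof -
  interpret max_degree_two G
    by unfold_locales (rule degree_le_two_if_cycle_free_square[OF cycle_free sym_parcs])
  obtain v where v: "C = with_proj (pair_component G v)"
    using component unfolding connected_components_eq_pair_component by blast
  interpret C: pair_bidirected_digraph "pair_component G v"
    by (rule pair_bidirected_digraph_pair_component)
  from component_path_or_cycle[OF component] show ?thesis
  proof (elim disjE exE)
    fix n assume n: "is_cycle_of_length n C"
    then obtain g where cycle: "simple_cycle (parcs (pair_component G v)) n g"
      unfolding v using is_cycle_of_length_imp_simple_cycle[OF C.pair_wf_digraph_axioms] by blast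
    have "simple_cycle (parcs G) n (id \<circ> g)"
      by (rule simple_cycle_map[OF cycle]) (auto simp: pair_component_def restrict_pair_def)
    then have "n = 4"
      using cycle_free_square_imp_length_4[OF cycle_free] by blast
    then show ?thesis
      using n by simp
  qed simp
qed

lemma cycle_free_square_if_components:
  assumes "\<And>v. v \<in> pverts G \<Longrightarrow> cycle_free (square (parcs (pair_component G v)))"
  shows "cycle_free (square (parcs G))"
  unfolding cycle_free_def
proof (intro notI, elim exE)
  fix n g assume cycle: "simple_cycle (square (parcs G)) n g"
  define S where "S = (parcs G)\<^sup>* `` {g 0}"
  have closed: "parcs G `` S \<subseteq> S"
    unfolding S_def by (blast intro: rtrancl_into_rtrancl)
  then have "square (parcs G) `` S \<subseteq> S"
    unfolding square_def by blast
  then have sub: "g ` {..<n} \<subseteq> S"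
    by (rule simple_cycle_image_subset[OF cycle]) (simp add: S_def)
  have "(u, w) \<in> square (parcs (pair_component G (g 0)))"
    if "u \<in> S" "w \<in> S" "(u, w) \<in> square (parcs G)" for u w
    using that closed
    by (auto simp: square_def pair_component_def restrict_pair_def S_def[symmetric])
  then have "simple_cycle (square (parcs (pair_component G (g 0)))) n (id \<circ> g)"
    using sub by (intro simple_cycle_map[OF cycle]) auto
  moreover have "g 0 \<in> pverts G"
    using simple_cycle_length[OF cycle] simple_cycle_arc[OF cycle, of 0]
    by (auto simp: square_def dest: in_arcsD1)
  ultimately show False
    using assms unfolding cycle_free_def by blast
qed

theorem cycle_free_square_iff_components:
  "cycle_free (square (parcs G)) \<longleftrightarrow>
    (\<forall>C \<in> connected_components (with_proj G). is_path C \<or> is_cycle_of_length 4 C)"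
proof
  assume comps: "\<forall>C \<in> connected_components (with_proj G). is_path C \<or> is_cycle_of_length 4 C"
  show "cycle_free (square (parcs G))"
  proof (rule cycle_free_square_if_components)
    fix v assume "v \<in> pverts G"
    let ?C = "pair_component G v"
    interpret C: pair_bidirected_digraph ?C
      by (rule pair_bidirected_digraph_pair_component)
    have "is_path (with_proj ?C) \<or> is_cycle_of_length 4 (with_proj ?C)"
      using comps \<open>v \<in> pverts G\<close> unfolding connected_components_eq_pair_component by blast
    then consider (path) I where "digraph_iso (with_proj ?C) (with_proj (path_on I))"
      | (cycle) "digraph_iso (with_proj ?C) (with_proj (cycle_on 4))"
      unfolding is_path_def is_cycle_of_length_def by blast
    then show "cycle_free (square (parcs ?C))"
    proof cases
      case path
      then show ?thesis
        using cycle_free_square_path_on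
        by (rule cycle_free_square_iso[OF C.pair_wf_digraph_axioms])
    next
      case cycle
      then show ?thesis
        using cycle_free_square_cycle_on_4
        by (rule cycle_free_square_iso[OF C.pair_wf_digraph_axioms])
    qed
  qed
qed (use component_path_or_four_cycle in blast)

end

section \<open>Divisor graphs\<close>

lemma Inl_Inl_in_square_bipartite_divisor_graph_iff:
  "(Inl p, Inl q) \<in> square (parcs (bipartite_divisor_graph X)) \<longleftrightarrow>
    p \<noteq> q \<and> p \<in> rho X \<and> q \<in> rho X \<and> (\<exists>x\<in>star X. p dvd x \<and> q dvd x)"
  unfolding square_def relcomp_unfold bipartite_divisor_graph_def by auto

lemma Inr_Inr_in_square_bipartite_divisor_graph_iff:
  "(Inr x, Inr y) \<in> square (parcs (bipartite_divisor_graph X)) \<longleftrightarrow>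
    x \<noteq> y \<and> x \<in> star X \<and> y \<in> star X \<and> (\<exists>p\<in>rho X. p dvd x \<and> p dvd y)"
  unfolding square_def relcomp_unfold bipartite_divisor_graph_def by auto

lemma parcs_prime_vertex_graph:
  "parcs (prime_vertex_graph X) = inv_image (square (parcs (bipartite_divisor_graph X))) Inl"
proof -
  have "(\<exists>x\<in>X. p * q dvd x) \<longleftrightarrow> (\<exists>x\<in>star X. p dvd x \<and> q dvd x)"
    if "p \<noteq> q" "p \<in> rho X" "q \<in> rho X" for p q
  proof -
    have primes: "prime p" "prime q"
      using that(2,3) by (simp_all add: rho_def)
    have "p * q dvd x \<longleftrightarrow> p dvd x \<and> q dvd x" for x
      using primes_coprime[OF primes that(1)] by (meson divides_mult dvd_mult_left dvd_mult_right)
    moreover have "\<not> p dvd 1"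
      using primes(1) not_prime_unit by blast
    ultimately show ?thesis
      unfolding star_def by blast
  qed
  then have "(p, q) \<in> parcs (prime_vertex_graph X) \<longleftrightarrow>
      (Inl p, Inl q) \<in> square (parcs (bipartite_divisor_graph X))" for p q
    unfolding Inl_Inl_in_square_bipartite_divisor_graph_iff by (auto simp: prime_vertex_graph_def)
  then show ?thesis
    by auto
qed

lemma parcs_common_divisor_graph:
  "parcs (common_divisor_graph X) = inv_image (square (parcs (bipartite_divisor_graph X))) Inr"
proof -
  have "1 < gcd x y \<longleftrightarrow> (\<exists>p\<in>rho X. p dvd x \<and> p dvd y)"
    if "x \<noteq> y" "x \<in> star X" for x y
  proof -
    have "0 < gcd x y"
      using that(1) by (auto intro: gcd_pos_nat)
    then have "1 < gcd x y \<longleftrightarrow> gcd x y \<noteq> 1"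
      by linarith
    also have "\<dots> \<longleftrightarrow> (\<exists>p. prime p \<and> p dvd gcd x y)"
      using prime_factor_nat not_prime_unit by metis
    also have "\<dots> \<longleftrightarrow> (\<exists>p\<in>rho X. p dvd x \<and> p dvd y)"
      using that(2) unfolding rho_def star_def gcd_greatest_iff by blast
    finally show ?thesis .
  qed
  then have "(x, y) \<in> parcs (common_divisor_graph X) \<longleftrightarrow>
      (Inr x, Inr y) \<in> square (parcs (bipartite_divisor_graph X))" for x y
    unfolding Inr_Inr_in_square_bipartite_divisor_graph_iff by (auto simp: common_divisor_graph_def)
  then show ?thesis
    by auto
qed

lemma cycle_free_square_bipartite_divisor_graph_iff:
  "cycle_free (square (parcs (bipartite_divisor_graph X))) \<longleftrightarrow>
    cycle_free (parcs (common_divisor_graph X)) \<and> cycle_free (parcs (prime_vertex_graph X))"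
proof -
  let ?R = "square (parcs (bipartite_divisor_graph X))"
  have "?R `` range Inl \<subseteq> range Inl" "?R `` range Inr \<subseteq> range Inr"
    by (auto simp: square_def bipartite_divisor_graph_def)
  then show ?thesis
    using cycle_free_sum_iff[of ?R]
    by (auto simp: parcs_common_divisor_graph parcs_prime_vertex_graph)
qed

theorem theorem4p2:
  fixes X :: "nat set"
  assumes "X \<noteq> {}" and "\<forall>x\<in>X. 0 < x" and "X \<noteq> {1}"
  shows "acyclic_graph (with_proj (common_divisor_graph X)) \<and>
         acyclic_graph (with_proj (prime_vertex_graph X)) \<longleftrightarrow>
         (\<forall>C \<in> connected_components (with_proj (bipartite_divisor_graph X)).
            is_path C \<or> is_cycle_of_length 4 C)"
proof -
  interpret \<Gamma>: pair_bidirected_digraph "common_divisor_graph X"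
    by (rule pair_bidirected_common_divisor_graph)
  interpret \<Delta>: pair_bidirected_digraph "prime_vertex_graph X"
    by (rule pair_bidirected_prime_vertex_graph)
  interpret B: pair_bidirected_digraph "bipartite_divisor_graph X"
    by (rule pair_bidirected_bipartite_divisor_graph)
  have "acyclic_graph (with_proj (common_divisor_graph X)) \<and>
      acyclic_graph (with_proj (prime_vertex_graph X)) \<longleftrightarrow>
      cycle_free (square (parcs (bipartite_divisor_graph X)))"
    by (simp add: \<Gamma>.acyclic_graph_iff_cycle_free \<Delta>.acyclic_graph_iff_cycle_free
        cycle_free_square_bipartite_divisor_graph_iff)
  also note B.cycle_free_square_iff_components
  finally show ?thesis .
qed

end
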